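(* For every element $m$ of the monoid $\mathcal F(\emptyset)$ there exist a unique pair $k,l\in\mathbb N$ and a unique pair of sequences of natural numbers $$0\le i_1\le\dots\le i_k,\qquad j_1\ge\dots\ge j_l\ge 0$$ such that $$m=\eta_{i_1}\cdots\eta_{i_k}\,\varepsilon_{j_1}\cdots\varepsilon_{j_l}.$$ (If $k=0$, resp. $l=0$, the corresponding sequence is empty and the corresponding product is the neutral element $1$.)
   Context: $\mathbb N=\{0,1,2,\dots\}$. $\mathcal F(\emptyset)$ denotes the monoid generated by the symbols $\eta_k,\varepsilon_k$ ($k\in\mathbb N$) subject to the following relations (for all $i,j\in\mathbb N$ satisfying the indicated conditions): $$\varepsilon_i\varepsilon_j=\varepsilon_{j-1}\varepsilon_i\ (j>i),\qquad \eta_j\eta_i=\eta_i\eta_{j-1}\ (j>i),$$ $$\varepsilon_i\eta_j=\begin{cases}\eta_{j-1}\varepsilon_i & (j>i+1)\\ \eta_j\varepsilon_{i-1} & (i>j)\\ \varepsilon_{i-1}\eta_i & (i=j>0)\\ \varepsilon_i\eta_i & (j=i+1)\\ 1 & (i=j=0).\end{cases}$$ That is, $\mathcal F(\emptyset)$ is the quotient of the free monoid on these symbols by the congruence generated by these relations. *)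

theory Defs
  imports Main
begin

datatype gen = Eta nat | Eps nat

text \<open>Words over \<^typ>\<open>gen\<close> (lists under \<^term>\<open>(@)\<close>) are the free monoid on the generators.
  The side conditions ensure that no subtraction below is truncated.\<close>

inductive defining_relation :: "gen list \<Rightarrow> gen list \<Rightarrow> bool" where
  eps_eps: "j > i \<Longrightarrow> defining_relation [Eps i, Eps j] [Eps (j - 1), Eps i]"
| eta_eta: "j > i \<Longrightarrow> defining_relation [Eta j, Eta i] [Eta i, Eta (j - 1)]"
| eps_eta_less: "j > i + 1 \<Longrightarrow> defining_relation [Eps i, Eta j] [Eta (j - 1), Eps i]"
| eps_eta_greater: "i > j \<Longrightarrow> defining_relation [Eps i, Eta j] [Eta j, Eps (i - 1)]"
| eps_eta_eq: "i = j \<Longrightarrow> j > 0 \<Longrightarrow> defining_relation [Eps i, Eta j] [Eps (i - 1), Eta i]"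
| eps_eta_succ: "j = i + 1 \<Longrightarrow> defining_relation [Eps i, Eta j] [Eps i, Eta i]"
| eps_eta_zero: "i = 0 \<Longrightarrow> j = 0 \<Longrightarrow> defining_relation [Eps i, Eta j] []"

inductive F_cong :: "gen list \<Rightarrow> gen list \<Rightarrow> bool" where
  F_cong_base: "defining_relation u v \<Longrightarrow> F_cong u v"
| F_cong_refl: "F_cong u u"
| F_cong_sym: "F_cong u v \<Longrightarrow> F_cong v u"
| F_cong_trans: "F_cong u v \<Longrightarrow> F_cong v w \<Longrightarrow> F_cong u w"
| F_cong_append: "F_cong u u' \<Longrightarrow> F_cong v v' \<Longrightarrow> F_cong (u @ v) (u' @ v')"

lemma equivp_F_cong: "equivp F_cong"
  by (intro equivpI reflpI sympI transpI) (blast intro: F_cong.intros)+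

quotient_type F_empty = "gen list" / F_cong
  by (rule equivp_F_cong)

instantiation F_empty :: monoid_mult
begin

lift_definition one_F_empty :: F_empty is "[]" .

lift_definition times_F_empty :: "F_empty \<Rightarrow> F_empty \<Rightarrow> F_empty" is "(@)"
  by (rule F_cong_append)

instance
  by standard (transfer, simp add: F_cong_refl)+

end

lift_definition eta :: "nat \<Rightarrow> F_empty" is "\<lambda>k. [Eta k]" .

lift_definition eps :: "nat \<Rightarrow> F_empty" is "\<lambda>k. [Eps k]" .

end

theory Submission imports Defs begin

text \<open>
  The generators behave like the cofaces and codegeneracies of the simplex category, stretched out
  over a single infinite simplex: \<^term>\<open>eta i\<close> acts on \<open>\<nat>\<close> as the increasing injection that
  omits the value \<open>i\<close>, and \<^term>\<open>eps i\<close> as the monotone surjection that takes the value \<open>i\<close>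
  twice. The defining relations are the cosimplicial identities, so this is an action of the monoid.
  The one difference is that the identities
  \<open>\<epsilon>\<^sub>i \<eta>\<^sub>i = 1 = \<epsilon>\<^sub>i \<eta>\<^sub>i\<^sub>+\<^sub>1\<close> are not imposed but follow from the relations by descending to
  \<open>\<epsilon>\<^sub>0 \<eta>\<^sub>0 = 1\<close> (\<open>eps_eta_same\<close>).

  Existence is rewriting. Every \<open>\<epsilon>\<close> can be moved to the right of every \<open>\<eta>\<close>, possibly cancelling
  against one of them (\<open>eta_eps_factorization\<close>), and then each of the two blocks is put in order by
  insertion sort, where the larger of two indices drops by one when they change places
  (\<open>eta_block_sorted\<close>, \<open>eps_block_sorted\<close>).

  Uniqueness is the epi-mono factorization of the map by which a normal form acts. The \<open>\<epsilon>\<close>-block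
  acts by a surjection and the \<open>\<eta>\<close>-block by an injection, so the range of the whole map is the range
  of the injection, and this determines the sorted sequence \<open>is\<close>, one least omitted value at a time
  (\<open>cofaces_range_inject\<close>). Cancelling the injection leaves the surjection, which determines \<open>js\<close>
  in the same way through its fixed points (\<open>codegens_inject\<close>).
\<close>

section \<open>The generators as monoid elements\<close>

lemma F_empty_induct [case_names one eta eps]:
  assumes "P 1" "\<And>i m. P m \<Longrightarrow> P (eta i * m)" "\<And>i m. P m \<Longrightarrow> P (eps i * m)"
  shows "P m"
proof -
  have "P (abs_F_empty w)" for w
  proof (induction w)
    case Nil
    show ?case using assms(1) by (simp add: one_F_empty_def)
  next
    case (Cons g w)
    show ?case
    proof (cases g)
      case (Eta i)
      then have "abs_F_empty (g # w) = eta i * abs_F_empty w"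
        by (simp add: eta.abs_eq times_F_empty.abs_eq)
      then show ?thesis using assms(2) Cons.IH by simp
    next
      case (Eps i)
      then have "abs_F_empty (g # w) = eps i * abs_F_empty w"
        by (simp add: eps.abs_eq times_F_empty.abs_eq)
      then show ?thesis using assms(3) Cons.IH by simp
    qed
  qed
  then show ?thesis by (induction m rule: F_empty.abs_induct)
qed

lemma eps_mult_eps: "i < j \<Longrightarrow> eps i * eps j = eps (j - 1) * eps i"
  by transfer (use F_cong_base[OF eps_eps] in simp)

lemma eta_mult_eta: "i < j \<Longrightarrow> eta j * eta i = eta i * eta (j - 1)"
  by transfer (use F_cong_base[OF eta_eta] in simp)

lemma eps_mult_eta_less: "i + 1 < j \<Longrightarrow> eps i * eta j = eta (j - 1) * eps i"
  by transfer (use F_cong_base[OF eps_eta_less] in simp)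

lemma eps_mult_eta_greater: "j < i \<Longrightarrow> eps i * eta j = eta j * eps (i - 1)"
  by transfer (use F_cong_base[OF eps_eta_greater] in simp)

lemma eps_mult_eta_eq: "eps (Suc i) * eta (Suc i) = eps i * eta (Suc i)"
  by transfer (use F_cong_base[OF eps_eta_eq, of "Suc i" "Suc i" for i] in simp)

lemma eps_mult_eta_Suc: "eps i * eta (Suc i) = eps i * eta i"
  by transfer (use F_cong_base[OF eps_eta_succ] in simp)

lemma eps_zero_mult_eta_zero: "eps 0 * eta 0 = 1"
  by transfer (use F_cong_base[OF eps_eta_zero] in simp)

text \<open>The relations for \<open>i = j\<close> and \<open>j = i + 1\<close> alternately lower the index of \<open>\<epsilon>\<close> and that of
  \<open>\<eta>\<close>, until the relation for \<open>0\<close> applies.\<close>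

lemma eps_eta_same: "eps i * eta i = 1"
  by (induction i) (simp_all add: eps_zero_mult_eta_zero eps_mult_eta_eq eps_mult_eta_Suc)

section \<open>Existence of normal forms\<close>

text \<open>What makes the induction work is that an \<open>\<epsilon>\<close> meeting an \<open>\<eta>\<close> never multiplies: it either
  cancels or comes out as a single \<open>\<epsilon>\<close> on the other side.\<close>

lemma eps_past_eta_block:
  "\<exists>is' js. eps j * prod_list (map eta is) = prod_list (map eta is') * prod_list (map eps js)"
proof (induction "is" arbitrary: j)
  case Nil
  have "eps j * prod_list (map eta []) = prod_list (map eta []) * prod_list (map eps [j])"
    by simp
  then show ?case by blast
next
  case (Cons i "is")
  let ?E = "prod_list (map eta is)"
  have pass: ?case if swap: "eps j * eta i = eta i' * eps j'" for i' j'
  proof -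
    obtain is' js where "eps j' * ?E = prod_list (map eta is') * prod_list (map eps js)"
      using Cons.IH by blast
    then have "eps j * prod_list (map eta (i # is))
        = prod_list (map eta (i' # is')) * prod_list (map eps js)"
      using swap by (simp add: mult.assoc[symmetric]) (simp add: mult.assoc)
    then show ?thesis by blast
  qed
  consider "j + 1 < i" | "i < j" | "i = j \<or> i = Suc j" by linarith
  then show ?case
  proof cases
    case 1
    then show ?thesis using pass eps_mult_eta_less by blast
  next
    case 2
    then show ?thesis using pass eps_mult_eta_greater by blast
  next
    case 3
    then have "eps j * eta i = 1" by (auto simp: eps_mult_eta_Suc eps_eta_same)
    then have "eps j * prod_list (map eta (i # is)) = ?E * prod_list (map eps [])"
      by (simp add: mult.assoc[symmetric])
    then show ?thesis by blast
  qed
qed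

lemma eta_eps_factorization:
  "\<exists>is js. m = prod_list (map eta is) * prod_list (map eps js)"
proof (induction m rule: F_empty_induct)
  case one
  have "1 = prod_list (map eta []) * prod_list (map eps [])" by simp
  then show ?case by blast
next
  case (eta i m)
  then obtain "is" js where "m = prod_list (map eta is) * prod_list (map eps js)" by blast
  then have "eta i * m = prod_list (map eta (i # is)) * prod_list (map eps js)"
    by (simp add: mult.assoc)
  then show ?case by blast
next
  case (eps i m)
  then obtain "is" js where m: "m = prod_list (map eta is) * prod_list (map eps js)" by blast
  obtain is' js' where
    "eps i * prod_list (map eta is) = prod_list (map eta is') * prod_list (map eps js')"
    using eps_past_eta_block by blast
  then have "eps i * m = prod_list (map eta is') * prod_list (map eps (js' @ js))"
    unfolding m by (simp add: mult.assoc[symmetric])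
  then show ?case by blast
qed

fun insert_eta :: "nat \<Rightarrow> nat list \<Rightarrow> nat list" where
  "insert_eta j [] = [j]"
| "insert_eta j (i # is) = (if j \<le> i then j # i # is else i # insert_eta (j - 1) is)"

lemma prod_insert_eta: "prod_list (map eta (insert_eta j is)) = eta j * prod_list (map eta is)"
proof (induction "is" arbitrary: j)
  case (Cons i "is")
  have "eta i * (eta (j - 1) * P) = eta j * (eta i * P)" if "i < j" for P
    using eta_mult_eta[OF that] by (simp add: mult.assoc[symmetric])
  then show ?case using Cons.IH by auto
qed simp

lemma insert_eta_ge: "b \<le> j \<Longrightarrow> \<forall>i\<in>set is. b \<le> i \<Longrightarrow> \<forall>i\<in>set (insert_eta j is). b \<le> i"
  by (induction j "is" rule: insert_eta.induct) auto

lemma sorted_insert_eta: "sorted_wrt (\<le>) is \<Longrightarrow> sorted_wrt (\<le>) (insert_eta j is)"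
proof (induction j "is" rule: insert_eta.induct)
  case (2 j i "is")
  then show ?case using insert_eta_ge[of i "j - 1" "is"] by auto
qed simp

lemma eta_block_sorted:
  "\<exists>is'. sorted_wrt (\<le>) is' \<and> prod_list (map eta is') = prod_list (map eta is)"
proof (induction "is")
  case Nil
  show ?case by (rule exI[of _ "[]"]) simp
next
  case (Cons i "is")
  then obtain is' where "sorted_wrt (\<le>) is'" "prod_list (map eta is') = prod_list (map eta is)"
    by blast
  then have "sorted_wrt (\<le>) (insert_eta i is')
      \<and> prod_list (map eta (insert_eta i is')) = prod_list (map eta (i # is))"
    by (simp add: sorted_insert_eta prod_insert_eta)
  then show ?case by blast
qed

fun insert_eps :: "nat \<Rightarrow> nat list \<Rightarrow> nat list" where
  "insert_eps i [] = [i]"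
| "insert_eps i (j # js) = (if j \<le> i then i # j # js else (j - 1) # insert_eps i js)"

lemma prod_insert_eps: "prod_list (map eps (insert_eps i js)) = eps i * prod_list (map eps js)"
proof (induction js)
  case (Cons j js)
  have "eps (j - 1) * (eps i * P) = eps i * (eps j * P)" if "i < j" for P
    using eps_mult_eps[OF that] by (simp add: mult.assoc[symmetric])
  then show ?case using Cons.IH by auto
qed simp

text \<open>Here it is the entry being passed that decreases, so its new value \<open>b - 1\<close> must still bound
  the rest, although the rest may contain \<open>b\<close> itself. It does, because every such copy of \<open>b\<close>
  exceeds the inserted index and is lowered too.\<close>

lemma insert_eps_less:
  "sorted_wrt (\<ge>) js \<Longrightarrow> i < b \<Longrightarrow> \<forall>j\<in>set js. j \<le> b \<Longrightarrow> \<forall>j\<in>set (insert_eps i js). j < b"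
  by (induction js) auto

lemma sorted_insert_eps: "sorted_wrt (\<ge>) js \<Longrightarrow> sorted_wrt (\<ge>) (insert_eps i js)"
proof (induction js)
  case (Cons j js)
  then show ?case using insert_eps_less[of js i j] by force
qed simp

lemma eps_block_sorted:
  "\<exists>js'. sorted_wrt (\<ge>) js' \<and> prod_list (map eps js') = prod_list (map eps js)"
proof (induction js)
  case Nil
  show ?case by (rule exI[of _ "[]"]) simp
next
  case (Cons j js)
  then obtain js' where "sorted_wrt (\<ge>) js'" "prod_list (map eps js') = prod_list (map eps js)"
    by blast
  then have "sorted_wrt (\<ge>) (insert_eps j js')
      \<and> prod_list (map eps (insert_eps j js')) = prod_list (map eps (j # js))"
    by (simp add: sorted_insert_eps prod_insert_eps)
  then show ?case by blast
qed

section \<open>The action on the natural numbers\<close>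

definition coface :: "nat \<Rightarrow> nat \<Rightarrow> nat" where
  "coface i x = (if x < i then x else Suc x)"

definition codegen :: "nat \<Rightarrow> nat \<Rightarrow> nat" where
  "codegen i x = (if x \<le> i then x else x - 1)"

fun gen_act :: "gen \<Rightarrow> nat \<Rightarrow> nat" where
  "gen_act (Eta i) = coface i"
| "gen_act (Eps i) = codegen i"

fun word_act :: "gen list \<Rightarrow> nat \<Rightarrow> nat" where
  "word_act [] = id"
| "word_act (g # w) = gen_act g \<circ> word_act w"

lemma word_act_append: "word_act (u @ v) = word_act u \<circ> word_act v"
  by (induction u) (simp_all add: comp_assoc)

lemma word_act_cong: "F_cong u v \<Longrightarrow> word_act u = word_act v"
proof (induction rule: F_cong.induct)
  case (F_cong_base u v)
  \<comment> \<open>These are the cosimplicial identities.\<close>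
  then show ?case
    by (cases rule: defining_relation.cases) (auto simp: fun_eq_iff coface_def codegen_def)
qed (simp_all add: word_act_append)

lift_definition act :: "F_empty \<Rightarrow> nat \<Rightarrow> nat" is word_act
  by (rule word_act_cong)

lemma act_one: "act 1 = id"
  by transfer simp

lemma act_mult: "act (a * b) = act a \<circ> act b"
  by transfer (rule word_act_append)

lemma act_eta: "act (eta i) = coface i"
  by transfer simp

lemma act_eps: "act (eps i) = codegen i"
  by transfer simp

abbreviation cofaces :: "nat list \<Rightarrow> nat \<Rightarrow> nat" where
  "cofaces is \<equiv> act (prod_list (map eta is))"

abbreviation codegens :: "nat list \<Rightarrow> nat \<Rightarrow> nat" where
  "codegens js \<equiv> act (prod_list (map eps js))"

lemma cofaces_Cons: "cofaces (i # is) = coface i \<circ> cofaces is"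
  by (simp add: act_mult act_eta)

lemma codegens_snoc: "codegens (js @ [j]) = codegens js \<circ> codegen j"
  by (simp add: act_mult act_eps)

lemma inj_coface: "inj (coface i)"
  by (rule injI) (auto simp: coface_def split: if_splits)

lemma inj_cofaces: "inj (cofaces is)"
proof (induction "is")
  case (Cons i "is")
  then show ?case unfolding cofaces_Cons by (intro inj_compose inj_coface)
qed (simp add: act_one)

lemma surj_codegen: "surj (codegen i)"
proof (rule surjI)
  show "codegen i (coface i x) = x" for x by (auto simp: coface_def codegen_def)
qed

lemma surj_codegens: "surj (codegens js)"
proof (induction js rule: rev_induct)
  case (snoc j js)
  then show ?case unfolding codegens_snoc by (intro comp_surj surj_codegen)
qed (simp add: act_one)

section \<open>Uniqueness of normal forms\<close>

lemma cofaces_fixes: "\<forall>i\<in>set is. x < i \<Longrightarrow> cofaces is x = x"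
  by (induction "is") (auto simp: act_one act_mult act_eta coface_def)

text \<open>The head of a sorted sequence is the least value omitted by its product: that value is
  omitted by the outermost coface, and the others, of index at least as large, leave everything
  below it in place. The initial segment expresses this without assuming that a value is omitted, so
  that it also separates nonempty sequences from the empty one, for which it is all of \<open>\<nat>\<close>.\<close>

lemma cofaces_Cons_range_initial:
  assumes "sorted_wrt (\<le>) (i # is)"
  shows "{x. {..<x} \<subseteq> range (cofaces (i # is))} = {..i}"
proof -
  have "i \<notin> range (cofaces (i # is))"
    by (auto simp: act_mult act_eta coface_def split: if_splits)
  moreover have "y \<in> range (cofaces (i # is))" if "y < i" for y
  proof -
    have "cofaces (i # is) y = y"
      using assms that by (intro cofaces_fixes) auto
    then show ?thesis by (metis rangeI)
  qed
  ultimately show ?thesis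
    by (auto simp del: list.map) (meson lessThan_iff linorder_not_le subsetD)
qed

text \<open>The outermost coface can be read off from the range, and its injectivity lets it be
  cancelled, so the range of the remaining product is determined too.\<close>

lemma cofaces_range_inject:
  assumes "sorted_wrt (\<le>) is" "sorted_wrt (\<le>) is'" "range (cofaces is) = range (cofaces is')"
  shows "is = is'"
  using assms
proof (induction "is" arbitrary: is')
  case Nil
  then have "{x. {..<x} \<subseteq> range (cofaces is')} = UNIV"
    by (simp flip: Nil.prems(3) add: act_one)
  then have "is' \<noteq> i # is''" for i is''
    using Nil.prems(2) cofaces_Cons_range_initial[of i is''] by (auto simp del: list.map)
  then show ?case by (cases is') auto
next
  case (Cons i "is")
  have initial: "{x. {..<x} \<subseteq> range (cofaces is')} = {..i}"
    using cofaces_Cons_range_initial[OF Cons.prems(1)] Cons.prems(3) by simp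
  then have "is' \<noteq> []"
    by (auto simp: act_one)
  then obtain i' is'' where is': "is' = i' # is''"
    by (cases is') auto
  have "{..i} = {..i'}"
    using initial cofaces_Cons_range_initial[of i' is''] Cons.prems(2) unfolding is' by simp
  then have "i = i'" by simp
  have "coface i ` range (cofaces is) = coface i ` range (cofaces is'')"
    using Cons.prems(3) unfolding is' \<open>i = i'\<close> cofaces_Cons image_comp .
  then have "range (cofaces is) = range (cofaces is'')"
    by (simp only: inj_image_eq_iff[OF inj_coface])
  then show ?case using Cons.IH[of is''] Cons.prems is' \<open>i = i'\<close> by simp
qed

lemma codegens_le: "codegens js x \<le> x"
proof (induction js)
  case (Cons j js)
  then show ?case by (auto simp: act_mult act_eps codegen_def)
qed (simp add: act_one)

lemma codegens_fixes: "\<forall>j\<in>set js. x \<le> j \<Longrightarrow> codegens js x = x"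
  by (induction js) (auto simp: act_one act_mult act_eps codegen_def)

text \<open>The innermost codegeneracy has the least index \<open>j\<close>. It lowers every number above \<open>j\<close>, no
  codegeneracy raises a number, and none of index at least \<open>j\<close> moves the numbers up to \<open>j\<close>.\<close>

lemma codegens_snoc_fixed_points:
  assumes "sorted_wrt (\<ge>) (js @ [j])"
  shows "{x. codegens (js @ [j]) x = x} = {..j}"
proof -
  have "codegens (js @ [j]) x = x" if "x \<le> j" for x
    using assms that by (intro codegens_fixes) (auto simp: sorted_wrt_append)
  moreover have "codegens (js @ [j]) x < x" if "j < x" for x
    using that codegens_le[of js "x - 1"]
    by (simp add: codegens_snoc codegen_def del: map_append)
  ultimately show ?thesis
    by (auto simp del: map_append) (metis linorder_not_le less_irrefl)
qed

text \<open>The innermost codegeneracy can be read off from the fixed points, and its surjectivity lets it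
  be cancelled on the right.\<close>

lemma codegens_inject:
  assumes "sorted_wrt (\<ge>) js" "sorted_wrt (\<ge>) js'" "codegens js = codegens js'"
  shows "js = js'"
  using assms
proof (induction js arbitrary: js' rule: rev_induct)
  case Nil
  then have "{x. codegens js' x = x} = UNIV"
    by (simp flip: Nil.prems(3) add: act_one)
  then have "js' \<noteq> js'' @ [j]" for js'' j
    using Nil.prems(2) codegens_snoc_fixed_points[of js'' j] by (auto simp del: map_append)
  then show ?case by (cases js' rule: rev_cases) auto
next
  case (snoc j js)
  have fixed: "{x. codegens js' x = x} = {..j}"
    using codegens_snoc_fixed_points[OF snoc.prems(1)] snoc.prems(3) by simp
  then have "js' \<noteq> []"
    by (auto simp: act_one)
  then obtain j' js'' where js': "js' = js'' @ [j']"
    by (cases js' rule: rev_cases) auto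
  have "{..j} = {..j'}"
    using fixed codegens_snoc_fixed_points[of js'' j'] snoc.prems(2) unfolding js' by simp
  then have "j = j'" by simp
  have "codegens js \<circ> codegen j = codegens js'' \<circ> codegen j"
    using snoc.prems(3) unfolding js' \<open>j = j'\<close> codegens_snoc .
  then have "codegens js = codegens js''"
    unfolding fun_eq_iff comp_apply by (metis surjD[OF surj_codegen])
  then show ?case
    using snoc.IH[of js''] snoc.prems js' \<open>j = j'\<close> by (simp add: sorted_wrt_append)
qed

lemma normal_form_inject:
  assumes "sorted_wrt (\<le>) is" "sorted_wrt (\<le>) is'" "sorted_wrt (\<ge>) js" "sorted_wrt (\<ge>) js'"
    and "prod_list (map eta is) * prod_list (map eps js)
       = prod_list (map eta is') * prod_list (map eps js')"
  shows "is = is' \<and> js = js'"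
proof -
  have eq: "cofaces is \<circ> codegens js = cofaces is' \<circ> codegens js'"
    using assms(5) by (metis act_mult)
  then have "range (cofaces is) = range (cofaces is')"
    using surj_codegens by (metis image_comp)
  then have "is = is'" using assms cofaces_range_inject by blast
  moreover have "codegens js = codegens js'"
    using eq inj_cofaces[of is'] unfolding \<open>is = is'\<close> by (simp add: fun_eq_iff inj_eq)
  ultimately show ?thesis using assms codegens_inject by blast
qed

theorem theorem1:
  fixes m :: F_empty
  shows "\<exists>!(k, l, is, js). length is = k \<and> length js = l \<and>
           sorted_wrt (\<le>) is \<and> sorted_wrt (\<ge>) js \<and>
           m = prod_list (map eta is) * prod_list (map eps js)"
proof -
  obtain is0 js0 where m0: "m = prod_list (map eta is0) * prod_list (map eps js0)"
    using eta_eps_factorization by blast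
  obtain "is" where "is": "sorted_wrt (\<le>) is" "prod_list (map eta is) = prod_list (map eta is0)"
    using eta_block_sorted by blast
  obtain js where js: "sorted_wrt (\<ge>) js" "prod_list (map eps js) = prod_list (map eps js0)"
    using eps_block_sorted by blast
  have m: "m = prod_list (map eta is) * prod_list (map eps js)"
    using m0 "is" js by simp
  show ?thesis
  proof (rule ex1I[of _ "(length is, length js, is, js)"])
    show "case (length is, length js, is, js) of (k, l, is, js) \<Rightarrow>
      length is = k \<and> length js = l \<and> sorted_wrt (\<le>) is \<and> sorted_wrt (\<ge>) js \<and>
      m = prod_list (map eta is) * prod_list (map eps js)"
      using "is" js m by simp
  next
    fix t :: "nat \<times> nat \<times> nat list \<times> nat list"
    assume "case t of (k, l, is, js) \<Rightarrow>
      length is = k \<and> length js = l \<and> sorted_wrt (\<le>) is \<and> sorted_wrt (\<ge>) js \<and>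
      m = prod_list (map eta is) * prod_list (map eps js)"
    then show "t = (length is, length js, is, js)"
      using normal_form_inject "is"(1) js(1) m by (cases t) (simp, blast)
  qed
qed

end
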